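(* For every $n\ge 3$, the incidence structure obtained from the generalized cuboctahedron graph $CO(n)$ by $V$-construction is a $((3n)_4)$ configuration that can be realized as a point-circle configuration in the plane whose symmetry group is the dihedral group $D_n$ (of order $2n$).
   Context: The prism graph (circular ladder) over an $n$-gon is the Cartesian product $C_n\,\square\,K_2$; the generalized cuboctahedron graph $CO(n)$ is the line graph of this prism graph (equivalently the 1-skeleton of the medial of the $n$-gonal prism); it is 4-regular with $3n$ vertices. The $V$-construction of a graph $G$ is the incidence structure with points $V(G)$, blocks $\{N(v)\mid v\in V(G)\}$ where $N(v)$ is the neighbourhood of $v$, incidence being membership. An $(m_k)$ configuration is an incidence structure with $m$ points and $m$ blocks, each block incident with exactly $k$ points and each point with exactly $k$ blocks. A point-circle realization assigns distinct points of the plane to the points and distinct circles to the blocks so that each point lies on the circle of every block incident with it; its symmetry group is the group of isometries of the plane mapping the set of points and the set of circles onto themselves. *)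

theory Defs
  imports "HOL-Analysis.Analysis" "HOL-Algebra.Bij" "HOL-Algebra.Coset"
begin

section \<open>Graphs\<close>

text \<open>Simple graphs; an edge is the two-element set of its end vertices.\<close>

record 'v graph =
  verts :: "'v set"
  edges :: "'v set set"

text \<open>The cycle is a simple graph only for \<open>n \<ge> 3\<close> (or \<open>n = 0\<close>).\<close>

definition cycle_graph :: "nat \<Rightarrow> nat graph" where
  "cycle_graph n = \<lparr>verts = {..<n}, edges = {{i, (i + 1) mod n} | i. i < n}\<rparr>"

definition complete_graph :: "nat \<Rightarrow> nat graph" where
  "complete_graph n = \<lparr>verts = {..<n}, edges = {{i, j} | i j. i < n \<and> j < n \<and> i \<noteq> j}\<rparr>"

definition cartesian_product :: "'v graph \<Rightarrow> 'w graph \<Rightarrow> ('v \<times> 'w) graph" where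
  "cartesian_product G H =
    \<lparr>verts = verts G \<times> verts H,
     edges = {{(u, x), (u, y)} | u x y. u \<in> verts G \<and> {x, y} \<in> edges H}
           \<union> {{(u, x), (v, x)} | u v x. {u, v} \<in> edges G \<and> x \<in> verts H}\<rparr>"

definition line_graph :: "'v graph \<Rightarrow> 'v set graph" where
  "line_graph G =
    \<lparr>verts = edges G,
     edges = {{e, f} | e f. e \<in> edges G \<and> f \<in> edges G \<and> e \<noteq> f \<and> e \<inter> f \<noteq> {}}\<rparr>"

definition neighbourhood :: "'v graph \<Rightarrow> 'v \<Rightarrow> 'v set" where
  "neighbourhood G v = {w \<in> verts G. {v, w} \<in> edges G}"

definition prism_graph :: "nat \<Rightarrow> (nat \<times> nat) graph" where
  "prism_graph n = cartesian_product (cycle_graph n) (complete_graph 2)"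

definition generalized_cuboctahedron_graph :: "nat \<Rightarrow> (nat \<times> nat) set graph" where
  "generalized_cuboctahedron_graph n = line_graph (prism_graph n)"


section \<open>Incidence structures and configurations\<close>

record ('p, 'b) incidence_structure =
  points :: "'p set"
  blocks :: "'b set"
  incident :: "'p \<Rightarrow> 'b \<Rightarrow> bool"

definition V_construction :: "'v graph \<Rightarrow> ('v, 'v set) incidence_structure" where
  "V_construction G =
    \<lparr>points = verts G, blocks = neighbourhood G ` verts G, incident = (\<in>)\<rparr>"

text \<open>Finiteness is explicit because the cardinality of an infinite set is \<open>0\<close>.\<close>

definition is_configuration :: "('p, 'b) incidence_structure \<Rightarrow> nat \<Rightarrow> nat \<Rightarrow> bool" where
  "is_configuration S m k \<longleftrightarrow>
     finite (points S) \<and> card (points S) = m \<and>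
     finite (blocks S) \<and> card (blocks S) = m \<and>
     (\<forall>b \<in> blocks S. card {p \<in> points S. incident S p b} = k) \<and>
     (\<forall>p \<in> points S. card {b \<in> blocks S. incident S p b} = k)"


section \<open>Point-circle realizations\<close>

text \<open>The Euclidean plane is modelled by the complex numbers with their usual metric.\<close>

type_synonym plane = complex

definition is_circle :: "plane set \<Rightarrow> bool" where
  "is_circle C \<longleftrightarrow> (\<exists>c r. r > 0 \<and> C = sphere c r)"

definition point_circle_realization ::
    "('p, 'b) incidence_structure \<Rightarrow> ('p \<Rightarrow> plane) \<Rightarrow> ('b \<Rightarrow> plane set) \<Rightarrow> bool" where
  "point_circle_realization S pt circ \<longleftrightarrow>
     inj_on pt (points S) \<and>
     inj_on circ (blocks S) \<and>
     (\<forall>b \<in> blocks S. is_circle (circ b)) \<and>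
     (\<forall>p \<in> points S. \<forall>b \<in> blocks S. incident S p b \<longrightarrow> pt p \<in> circ b)"

definition plane_isometries :: "(plane \<Rightarrow> plane) set" where
  "plane_isometries = {f. bij f \<and> (\<forall>x y. dist (f x) (f y) = dist x y)}"

text \<open>The symmetry group of a set \<open>P\<close> of points together with a set \<open>\<C>\<close> of circles, as a
  subgroup of the group of all bijections of the plane (whose multiplication is composition).\<close>

definition symmetry_group :: "plane set \<Rightarrow> plane set set \<Rightarrow> (plane \<Rightarrow> plane) monoid" where
  "symmetry_group P \<C> = (BijGroup UNIV)
     \<lparr>carrier := {f \<in> plane_isometries. f ` P = P \<and> (\<lambda>C. f ` C) ` \<C> = \<C>}\<rparr>"

text \<open>The pair \<open>(a, s)\<close> stands for \<open>\<rho>\<^sup>a \<sigma>\<^sup>s\<close> with \<open>\<rho>\<close> of order \<open>n\<close>, \<open>\<sigma>\<close> of order \<open>2\<close>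
  (\<open>s\<close> tells whether \<open>\<sigma>\<close> occurs) and \<open>\<sigma> \<rho> = \<rho>\<^sup>-\<^sup>1 \<sigma>\<close>.\<close>

definition dihedral_group :: "nat \<Rightarrow> (int \<times> bool) monoid" where
  "dihedral_group n =
    \<lparr>carrier = {0..<int n} \<times> UNIV,
     mult = (\<lambda>(a, s) (b, t). ((a + (if s then - b else b)) mod int n, s \<noteq> t)),
     one = (0, False)\<rparr>"

lemma subgroup_symmetry:
  "subgroup {f \<in> plane_isometries. f ` P = P \<and> (\<lambda>C. f ` C) ` \<C> = \<C>} (BijGroup UNIV)"
    (is "subgroup ?H _")
proof -
  interpret B: group "BijGroup (UNIV :: plane set)" by (rule group_BijGroup)
  have carr: "f \<in> carrier (BijGroup UNIV) \<longleftrightarrow> bij f" for f :: "plane \<Rightarrow> plane"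
    by (simp add: BijGroup_def Bij_def)
  have mult: "f \<otimes>\<^bsub>BijGroup UNIV\<^esub> g = f \<circ> g" if "bij f" "bij g" for f g :: "plane \<Rightarrow> plane"
    using that by (simp add: BijGroup_def Bij_def compose_def fun_eq_iff)
  have one: "\<one>\<^bsub>BijGroup UNIV\<^esub> = (id :: plane \<Rightarrow> plane)"
    by (simp add: BijGroup_def fun_eq_iff)
  have inv: "m_inv (BijGroup UNIV) f = inv_into UNIV f" if f: "bij f" for f :: "plane \<Rightarrow> plane"
  proof (rule B.inv_equality)
    show "inv_into UNIV f \<otimes>\<^bsub>BijGroup UNIV\<^esub> f = \<one>\<^bsub>BijGroup UNIV\<^esub>"
      using f by (simp add: mult one bij_imp_bij_inv bij_is_inj)
  qed (use f in \<open>simp_all add: carr bij_imp_bij_inv\<close>)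
  show ?thesis
  proof (rule B.subgroupI)
    show "?H \<subseteq> carrier (BijGroup UNIV)" by (auto simp: carr plane_isometries_def)
    show "?H \<noteq> {}" by (rule ex_in_conv[THEN iffD1], rule exI[of _ id])
        (simp add: plane_isometries_def)
  next
    fix f assume f: "f \<in> ?H"
    let ?g = "inv_into UNIV f"
    have bf: "bij f" and d: "\<And>x y. dist (f x) (f y) = dist x y"
      and P: "f ` P = P" and C: "(\<lambda>C. f ` C) ` \<C> = \<C>"
      using f by (auto simp: plane_isometries_def)
    have fg: "f (?g x) = x" and gf: "?g (f x) = x" for x
      using bf by (simp_all add: bij_is_surj surj_f_inv_f bij_is_inj)
    have gi: "?g ` f ` X = X" for X by (simp add: image_image gf)
    have "dist (?g x) (?g y) = dist x y" for x y using d[of "?g x" "?g y"] by (simp add: fg)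
    moreover have "?g ` P = P" using gi[of P] by (simp add: P)
    moreover have "(\<lambda>C. ?g ` C) ` \<C> = \<C>"
    proof -
      have "(\<lambda>C. ?g ` C) ` (\<lambda>C. f ` C) ` \<C> = \<C>" by (simp only: image_image[of "\<lambda>C. ?g ` C"] gi image_ident)
      then show ?thesis by (simp only: C)
    qed
    ultimately show "m_inv (BijGroup UNIV) f \<in> ?H"
      using bf by (simp add: inv plane_isometries_def bij_imp_bij_inv)
  next
    fix f g assume f: "f \<in> ?H" and g: "g \<in> ?H"
    have "(\<lambda>C. (f \<circ> g) ` C) ` \<C> = (\<lambda>C. f ` C) ` (\<lambda>C. g ` C) ` \<C>"
      by (simp only: image_comp[symmetric] image_image)
    then have "(\<lambda>C. (f \<circ> g) ` C) ` \<C> = \<C>" using f g by simp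
    moreover have "(f \<circ> g) ` P = P" using f g by (simp only: image_comp[symmetric] mem_Collect_eq)
    moreover have "f \<circ> g \<in> plane_isometries" using f g by (auto simp: plane_isometries_def bij_comp)
    ultimately show "f \<otimes>\<^bsub>BijGroup UNIV\<^esub> g \<in> ?H"
      using f g mult[of f g] by (simp add: plane_isometries_def)
  qed
qed

lemma group_symmetry_group: "group (symmetry_group P \<C>)"
  unfolding symmetry_group_def
  by (rule group.subgroup_imp_group[OF group_BijGroup subgroup_symmetry])

lemma group_dihedral_group:
  assumes "n > 0" shows "group (dihedral_group n)"
proof (rule groupI)
  fix x assume "x \<in> carrier (dihedral_group n)"
  then obtain a s where x: "x = (a, s)" "0 \<le> a" "a < int n" by (auto simp: dihedral_group_def)
  show "\<exists>y \<in> carrier (dihedral_group n). y \<otimes>\<^bsub>dihedral_group n\<^esub> x = \<one>\<^bsub>dihedral_group n\<^esub>"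
    by (rule bexI[of _ "(if s then a else (- a) mod int n, s)"])
      (use x assms in \<open>auto simp: dihedral_group_def mod_simps\<close>)
qed (use assms in \<open>auto simp: dihedral_group_def mod_simps algebra_simps\<close>)

lemma order_dihedral_group: "order (dihedral_group n) = 2 * n"
  by (simp add: order_def dihedral_group_def card_cartesian_product)

end

theory Submission
  imports Defs
begin

text \<open>
  Place the edges of one rim of the prism at equally spaced points of a circle about the origin,
  those of the other rim at the same angles on a second circle, and the spokes on a third circle
  at the angles halfway between. The four neighbours of any edge then form an isosceles trapezoid,
  so they are concyclic unless they are collinear; the radii only have to be chosen such that this
  does not happen and the \<open>3 * n\<close> circles are distinct. As the three radii differ, the configuration has no symmetries
  beyond the dihedral ones: a symmetry fixes the centroid \<open>0\<close>, so it has the form \<open>u * z\<close> or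
  \<open>u * cnj z\<close>, and since it maps spoke points to spoke points, \<open>u\<close> is an \<open>n\<close>-th root of unity.
\<close>

subsection \<open>The neighbourhood structure of the cuboctahedron graph\<close>

text \<open>A label \<open>(i, t)\<close>, with \<open>i\<close> read modulo \<open>n\<close>, stands for the \<open>i\<close>-th edge of the rim \<open>t\<close> if
  \<open>t < 2\<close> and for the \<open>i\<close>-th spoke if \<open>t = 2\<close>.\<close>

definition residue :: "nat \<Rightarrow> int \<Rightarrow> nat" where
  "residue n i = nat (i mod int n)"

definition prism_edge :: "nat \<Rightarrow> int \<times> nat \<Rightarrow> (nat \<times> nat) set" where
  "prism_edge n = (\<lambda>(i, t). if t = 2 then {(residue n i, 0), (residue n i, 1)}
     else {(residue n i, t), (residue n (i + 1), t)})"

definition label_nbrs :: "int \<times> nat \<Rightarrow> (int \<times> nat) set" where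
  "label_nbrs = (\<lambda>(i, t). if t = 2 then {(i, 0), (i, 1), (i - 1, 0), (i - 1, 1)}
     else {(i - 1, t), (i + 1, t), (i, 2), (i + 1, 2)})"

abbreviation labels :: "(int \<times> nat) set" where
  "labels \<equiv> UNIV \<times> {..2}"

lemma residue_eq_iff:
  assumes "n > 0"
  shows "residue n i = residue n j \<longleftrightarrow> int n dvd i - j"
  using assms by (simp add: residue_def eq_nat_nat_iff mod_eq_dvd_iff)

lemma residue_less: "n > 0 \<Longrightarrow> residue n i < n"
  by (simp add: residue_def nat_less_iff)

lemma residue_of_nat: "i < n \<Longrightarrow> residue n (int i) = i"
  by (simp add: residue_def)

lemma residue_Suc: "residue n (int i + 1) = (i + 1) mod n"
  by (metis nat_int of_nat_1 of_nat_add of_nat_mod residue_def)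

text \<open>With \<open>i\<close> an arbitrary integer, the edge closing the cycle needs no separate
  case.\<close>

lemma cycle_edge_iff:
  assumes "n > 0"
  shows "{u, v} \<in> edges (cycle_graph n) \<longleftrightarrow>
    (\<exists>i. {u, v} = {residue n i, residue n (i + 1)})"
proof -
  have "\<exists>j<n. {residue n i, residue n (i + 1)} = {j, (j + 1) mod n}" for i
  proof (intro exI[of _ "residue n i"] conjI)
    have "residue n (i + 1) = residue n (int (residue n i) + 1)"
      using assms by (simp add: residue_def mod_simps)
    then show "{residue n i, residue n (i + 1)} = {residue n i, (residue n i + 1) mod n}"
      by (simp only: residue_Suc)
  qed (use assms residue_less in blast)
  moreover have "\<exists>i. {j, (j + 1) mod n} = {residue n i, residue n (i + 1)}" if "j < n" for j
    using that by (metis residue_Suc residue_of_nat)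
  ultimately show ?thesis
    unfolding cycle_graph_def by auto metis
qed

lemma complete_graph_2_edge_iff:
  "{x, y} \<in> edges (complete_graph 2) \<longleftrightarrow> x < 2 \<and> y < 2 \<and> x \<noteq> y"
  by (auto simp: complete_graph_def doubleton_eq_iff)

text \<open>Every edge has infinitely many labels, one for each integer representing its index
  modulo \<open>n\<close>. This turns adjacency into divisibility of index differences.\<close>

lemma edges_prism_graph:
  assumes "n > 0"
  shows "edges (prism_graph n) = prism_edge n ` labels"
proof (intro equalityI subsetI)
  fix e assume "e \<in> edges (prism_graph n)"
  then consider (spoke) u x y where "e = {(u, x), (u, y)}" "u < n" "x < 2" "y < 2" "x \<noteq> y"
    | (rim) u v x where "e = {(u, x), (v, x)}" "{u, v} \<in> edges (cycle_graph n)" "x < 2"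
    by (auto simp: prism_graph_def cartesian_product_def complete_graph_2_edge_iff)
       (auto simp: cycle_graph_def complete_graph_def)
  then show "e \<in> prism_edge n ` labels"
  proof cases
    case spoke
    then have "e = prism_edge n (int u, 2)"
      by (auto simp: prism_edge_def residue_of_nat less_2_cases_iff)
    then show ?thesis by blast
  next
    case rim
    then obtain i where "{u, v} = {residue n i, residue n (i + 1)}"
      using cycle_edge_iff[OF assms] by blast
    then have "e = prism_edge n (i, x)"
      using rim by (auto simp: prism_edge_def doubleton_eq_iff)
    then show ?thesis using rim by auto
  qed
next
  fix e assume "e \<in> prism_edge n ` labels"
  then obtain i t where e: "e = prism_edge n (i, t)" and "t \<le> 2" by auto
  then consider "t = 2" | "t < 2" by linarith
  then show "e \<in> edges (prism_graph n)"
  proof cases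
    case 1
    then have "e = {(residue n i, 0), (residue n i, 1)}" by (simp add: e prism_edge_def)
    moreover have "residue n i \<in> verts (cycle_graph n)"
      using residue_less[OF assms] by (simp add: cycle_graph_def)
    moreover have "{0, 1} \<in> edges (complete_graph 2)"
      by (simp only: complete_graph_2_edge_iff) simp
    ultimately show ?thesis
      unfolding prism_graph_def cartesian_product_def by auto
  next
    case 2
    then have "e = {(residue n i, t), (residue n (i + 1), t)}" by (simp add: e prism_edge_def)
    moreover have "{residue n i, residue n (i + 1)} \<in> edges (cycle_graph n)"
      using cycle_edge_iff[OF assms] by blast
    moreover have "t \<in> verts (complete_graph 2)"
      using 2 by (simp add: complete_graph_def)
    ultimately show ?thesis
      unfolding prism_graph_def cartesian_product_def by auto
  qed
qed

section \<open>Adjacency of labelled edges as divisibility\<close>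

text \<open>Indices that differ by 1 or 2 stay distinct modulo \<open>n\<close>; this is how
  \<open>n \<ge> 3\<close> enters the combinatorics.\<close>

lemma not_dvd_small:
  assumes "n \<ge> 3" "0 < \<bar>k\<bar>" "\<bar>k\<bar> < 3"
  shows "\<not> int n dvd k"
  using assms dvd_imp_le_int[of k "int n"] by auto

text \<open>Otherwise \<open>n\<close> would divide the difference, which is 1 or 2 in absolute
  value.\<close>

lemma not_dvd_both:
  assumes "n \<ge> 3" "int n dvd k" "0 < \<bar>k - l\<bar>" "\<bar>k - l\<bar> < 3"
  shows "\<not> int n dvd l"
  using not_dvd_small[OF assms(1,3,4)] assms(2) dvd_diff by blast

lemma residue_succ_eq_iff:
  assumes "n > 0"
  shows "residue n (i + 1) = residue n (j + 1) \<longleftrightarrow> residue n i = residue n j"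
  using assms by (simp add: residue_eq_iff)

text \<open>As two-element sets, rim edges can agree straight or crosswise. Crosswise agreement
  would make \<open>n\<close> divide both \<open>i - j - 1\<close> and \<open>i - j + 1\<close>,
  which differ by 2.\<close>

lemma prism_edge_eq_iff:
  assumes "n \<ge> 3" "t \<le> 2" "u \<le> 2"
  shows "prism_edge n (i, t) = prism_edge n (j, u) \<longleftrightarrow> t = u \<and> int n dvd i - j"
proof -
  have n: "n > 0" using assms by simp
  have "\<not> (residue n i = residue n (j + 1) \<and> residue n (i + 1) = residue n j)"
    using not_dvd_both[OF assms(1), of "i - (j + 1)" "(i + 1) - j"] n
    by (auto simp: residue_eq_iff)
  moreover have "residue n i \<noteq> residue n (i + 1)" for i
    using not_dvd_small[OF assms(1), of "-1"] n by (simp add: residue_eq_iff)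
  ultimately show ?thesis
    using assms n
    by (auto simp: prism_edge_def doubleton_eq_iff residue_eq_iff[symmetric] residue_succ_eq_iff
        numeral_2_eq_2 le_Suc_eq)
qed

lemma prism_edge_inter_iff:
  assumes "n \<ge> 3" "t \<le> 2" "u \<le> 2"
  shows "prism_edge n (i, t) \<inter> prism_edge n (j, u) \<noteq> {} \<and> prism_edge n (i, t) \<noteq> prism_edge n (j, u)
    \<longleftrightarrow> prism_edge n (j, u) \<in> prism_edge n ` label_nbrs (i, t)"
proof -
  have n: "n > 0" using assms by simp
  have neg: "int n dvd a - b \<longleftrightarrow> int n dvd b - a" for a b
    by (metis dvd_minus_iff minus_diff_eq)
  \<comment> \<open>Removing the edge itself from the edges that meet it must not remove its
    successor or predecessor.\<close>
  have succ: "int n dvd j - i \<Longrightarrow> \<not> int n dvd j - i - 1" "int n dvd j - i \<Longrightarrow> \<not> int n dvd j - i + 1" 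
    using not_dvd_both[OF assms(1), of "j - i" "j - i - 1"]
      not_dvd_both[OF assms(1), of "j - i" "j - i + 1"] by auto
  consider "t = 2" "u = 2" | "t = 2" "u < 2" | "t < 2" "u = 2" | "t < 2" "u < 2"
    using assms by linarith
  then show ?thesis
  proof cases
    case 1
    then show ?thesis using assms n succ
      by (auto simp: label_nbrs_def prism_edge_eq_iff) (auto simp: prism_edge_def residue_eq_iff neg)
  next
    case 2
    then have "prism_edge n (i, t) \<inter> prism_edge n (j, u) \<noteq> {} \<longleftrightarrow> int n dvd j - i \<or> int n dvd j + 1 - i"
      using n by (auto simp: prism_edge_def residue_eq_iff neg[of i] less_2_cases_iff)
    with 2 show ?thesis using assms n
      by (auto simp: label_nbrs_def prism_edge_eq_iff less_2_cases_iff algebra_simps)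
  next
    case 3
    then have "prism_edge n (i, t) \<inter> prism_edge n (j, u) \<noteq> {} \<longleftrightarrow> int n dvd j - i \<or> int n dvd j - (i + 1)"
      using n by (auto simp: prism_edge_def residue_eq_iff neg[of _ j] less_2_cases_iff)
    with 3 show ?thesis using assms n
      by (auto simp: label_nbrs_def prism_edge_eq_iff less_2_cases_iff algebra_simps)
  next
    case 4
    then have "prism_edge n (i, t) \<inter> prism_edge n (j, u) \<noteq> {} \<longleftrightarrow>
        t = u \<and> (int n dvd j - i \<or> int n dvd j - (i + 1) \<or> int n dvd j + 1 - i)"
      using n by (auto simp: prism_edge_def residue_eq_iff neg[of _ j] neg[of _ "j + 1"])
    with 4 show ?thesis using assms n succ
      by (auto simp: label_nbrs_def prism_edge_eq_iff neg[of i] algebra_simps)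
  qed
qed

lemma label_nbrs_subset: "x \<in> labels \<Longrightarrow> label_nbrs x \<subseteq> labels"
  by (auto simp: label_nbrs_def split: prod.splits if_splits)

lemma verts_CO:
  "n > 0 \<Longrightarrow> verts (generalized_cuboctahedron_graph n) = prism_edge n ` labels"
  by (simp add: generalized_cuboctahedron_graph_def line_graph_def edges_prism_graph)

lemma neighbourhood_line_graph:
  "v \<in> edges G \<Longrightarrow>
    neighbourhood (line_graph G) v = {w \<in> edges G. v \<inter> w \<noteq> {} \<and> v \<noteq> w}"
  by (auto simp: neighbourhood_def line_graph_def doubleton_eq_iff)

lemma neighbourhood_CO:
  assumes "n \<ge> 3" "x \<in> labels"
  shows "neighbourhood (generalized_cuboctahedron_graph n) (prism_edge n x) = prism_edge n ` label_nbrs x"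
proof -
  obtain i t where x: "x = (i, t)" "t \<le> 2" using assms by auto
  have "neighbourhood (generalized_cuboctahedron_graph n) (prism_edge n x) =
      {w \<in> prism_edge n ` labels. prism_edge n x \<inter> w \<noteq> {} \<and> prism_edge n x \<noteq> w}"
    using assms unfolding generalized_cuboctahedron_graph_def
    by (subst neighbourhood_line_graph) (simp_all add: edges_prism_graph)
  also have "\<dots> = {w \<in> prism_edge n ` labels. w \<in> prism_edge n ` label_nbrs x}"
    unfolding x by (intro Collect_cong conj_cong refl) (use prism_edge_inter_iff[OF assms(1) x(2)] in force)
  also have "\<dots> = prism_edge n ` label_nbrs x"
    using label_nbrs_subset[OF assms(2)] by auto
  finally show ?thesis .
qed

section \<open>The counts that make a configuration\<close>

lemma card_verts_CO:
  assumes "n \<ge> 3"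
  shows "finite (verts (generalized_cuboctahedron_graph n))"
    and "card (verts (generalized_cuboctahedron_graph n)) = 3 * n"
proof -
  \<comment> \<open>Reducing indices modulo \<open>n\<close> leaves exactly one label per
    edge.\<close>
  let ?L = "{0..<int n} \<times> {..2::nat}"
  have "prism_edge n (i, t) \<in> prism_edge n ` ?L" if "t \<le> 2" for i t
  proof (rule image_eqI)
    show "prism_edge n (i, t) = prism_edge n (i mod int n, t)"
      using assms that by (simp add: prism_edge_eq_iff flip: mod_eq_dvd_iff)
  qed (use assms that in auto)
  then have V: "verts (generalized_cuboctahedron_graph n) = prism_edge n ` ?L"
    using assms by (auto simp: verts_CO)
  have "inj_on (prism_edge n) ?L"
    using assms by (auto simp: inj_on_def prism_edge_eq_iff simp flip: mod_eq_dvd_iff)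
  then show "card (verts (generalized_cuboctahedron_graph n)) = 3 * n"
    by (simp add: V card_image card_cartesian_product)
  show "finite (verts (generalized_cuboctahedron_graph n))"
    by (simp add: V)
qed

text \<open>Any two of the four neighbouring labels have different types or indices that differ by 1
  or 2, so they denote different edges.\<close>

lemma card_neighbourhood_CO:
  assumes "n \<ge> 3" "v \<in> verts (generalized_cuboctahedron_graph n)"
  shows "card (neighbourhood (generalized_cuboctahedron_graph n) v) = 4"
proof -
  obtain i t where v: "v = prism_edge n (i, t)" "t \<le> 2"
    using assms by (auto simp: verts_CO)
  have "card (label_nbrs (i, t)) = 4"
    using v by (auto simp: label_nbrs_def card_insert_if)
  moreover have "inj_on (prism_edge n) (label_nbrs (i, t))"
    using assms(1) v not_dvd_small[OF assms(1), of 1] not_dvd_small[OF assms(1), of 2]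
      not_dvd_small[OF assms(1), of "-1"] not_dvd_small[OF assms(1), of "-2"]
    by (auto simp: inj_on_def label_nbrs_def prism_edge_eq_iff)
  ultimately show ?thesis
    using v assms by (simp add: neighbourhood_CO card_image)
qed

text \<open>Ensures that there are as many blocks as points. The types occurring in a neighbourhood
  reveal the type of the vertex, since a spoke meets both rims and no spoke, while a rim edge meets
  spokes and only its own rim. The index is then recovered from a pair of consecutive
  residues.\<close>

lemma inj_on_neighbourhood_CO:
  assumes "n \<ge> 3"
  shows "inj_on (neighbourhood (generalized_cuboctahedron_graph n))
    (verts (generalized_cuboctahedron_graph n))"
proof (rule inj_onI)
  fix v w assume vw: "v \<in> verts (generalized_cuboctahedron_graph n)"
    "w \<in> verts (generalized_cuboctahedron_graph n)"
    and N: "neighbourhood (generalized_cuboctahedron_graph n) v =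
      neighbourhood (generalized_cuboctahedron_graph n) w"
  obtain i t where v: "v = prism_edge n (i, t)" "t \<le> 2"
    using assms vw by (auto simp: verts_CO)
  obtain j u where w: "w = prism_edge n (j, u)" "u \<le> 2"
    using assms vw by (auto simp: verts_CO)
  have eq: "prism_edge n ` label_nbrs (i, t) = prism_edge n ` label_nbrs (j, u)"
    using N v w assms by (simp add: neighbourhood_CO)
  have mem: "\<exists>l m. (l, m) \<in> label_nbrs (j, u) \<and> m = s \<and> int n dvd k - l"
    if "(k, s) \<in> label_nbrs (i, t)" for k s
  proof -
    have "prism_edge n (k, s) \<in> prism_edge n ` label_nbrs (j, u)"
      using that eq by blast
    then obtain l m where lm: "(l, m) \<in> label_nbrs (j, u)" "prism_edge n (k, s) = prism_edge n (l, m)"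
      by auto
    then have "(l, m) \<in> labels" "(k, s) \<in> labels"
      using v(2) w(2) that label_nbrs_subset[of "(i, t)"] label_nbrs_subset[of "(j, u)"] by blast+
    then show ?thesis
      using lm prism_edge_eq_iff[OF assms, of s m k l] by auto
  qed
  \<comment> \<open>Excludes that two pairs of consecutive residues agree with their members
    swapped.\<close>
  have neg: "\<not> (int n dvd i - j - 1 \<and> int n dvd i - j + 1)"
    using not_dvd_both[OF assms, of "i - j - 1" "i - j + 1"] by auto
  have "t = u \<and> int n dvd i - j"
  proof (cases "t = 2")
    case True
    have 1: "u = 2"
      using mem[of i 0] mem[of i 1] True w(2) by (auto simp: label_nbrs_def split: if_splits)
    with True mem[of i 0] mem[of "i - 1" 0] neg show ?thesis
      by (auto simp: label_nbrs_def algebra_simps)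
  next
    case False
    have 1: "u \<noteq> 2"
      using mem[of i 2] False by (auto simp: label_nbrs_def split: if_splits)
    moreover have "u = t"
      using mem[of "i + 1" t] False 1 by (auto simp: label_nbrs_def split: if_splits)
    ultimately show ?thesis
      using False mem[of i 2] mem[of "i + 1" 2] neg
      by (auto simp: label_nbrs_def algebra_simps)
  qed
  then show "v = w" using v w assms by (simp add: prism_edge_eq_iff)
qed

text \<open>Adjacency is symmetric, so the blocks through \<open>p\<close> are the neighbourhoods of
  the neighbours of \<open>p\<close>; by injectivity their number is the degree of
  \<open>p\<close>.\<close>

lemma is_configuration_V_construction:
  assumes "finite (verts G)" "card (verts G) = m" "inj_on (neighbourhood G) (verts G)"
    and deg: "\<And>v. v \<in> verts G \<Longrightarrow> card (neighbourhood G v) = k"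
  shows "is_configuration (V_construction G) m k"
proof -
  have sub: "neighbourhood G v \<subseteq> verts G" for v
    by (auto simp: neighbourhood_def)
  have "{p \<in> verts G. p \<in> neighbourhood G v} = neighbourhood G v" for v
    using sub by blast
  moreover have "card {b \<in> neighbourhood G ` verts G. p \<in> b} = k" if p: "p \<in> verts G" for p
  proof -
    have "{b \<in> neighbourhood G ` verts G. p \<in> b} = neighbourhood G ` neighbourhood G p"
      using p by (auto simp: neighbourhood_def insert_commute)
    then show ?thesis
      using card_image[OF inj_on_subset[OF assms(3) sub]] deg[OF p] by simp
  qed
  ultimately show ?thesis
    using assms by (simp add: is_configuration_def V_construction_def card_image)
qed

subsection \<open>Placing the points and circles\<close>

text \<open>Angles are counted in units of \<open>pi / n\<close>: spokes have even and rim edges odd index.\<close>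

definition angle_index :: "int \<times> nat \<Rightarrow> int" where
  "angle_index = (\<lambda>(i, t). 2 * i + (if t = 2 then 0 else 1))"

definition place :: "nat \<Rightarrow> (nat \<Rightarrow> real) \<Rightarrow> int \<times> nat \<Rightarrow> complex" where
  "place n r x = of_real (r (snd x)) * cis (pi * of_int (angle_index x) / n)"

text \<open>The radius is the distance from the centre to a point of the block at angle \<open>pi / n\<close> from it.\<close>

definition label_circle :: "nat \<Rightarrow> (nat \<Rightarrow> real) \<Rightarrow> (nat \<Rightarrow> real) \<Rightarrow> int \<times> nat \<Rightarrow> complex set" where
  "label_circle n R X x = sphere (place n X x)
     (let a = R (if snd x = 2 then 0 else 2); b = X (snd x)
      in sqrt (a\<^sup>2 + b\<^sup>2 - 2 * a * b * cos (pi / n)))"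

section \<open>Roots of unity and injectivity of the placement\<close>

lemma cis_pi_eq_iff:
  assumes "n > 0"
  shows "cis (pi * of_int m / n) = cis (pi * of_int k / n) \<longleftrightarrow> 2 * int n dvd m - k"
proof -
  have "cis (pi * of_int m / n) = cis (pi * of_int k / n) \<longleftrightarrow>
      (\<exists>l::int. pi * of_int m / n = pi * of_int k / n + 2 * pi * l)"
    using sin_cos_eq_iff[of "pi * of_int m / n" "pi * of_int k / n"] by (auto simp: complex_eq_iff)
  also have "\<dots> \<longleftrightarrow> (\<exists>l::int. pi * real_of_int m = pi * of_int (k + 2 * int n * l))"
    using assms by (simp add: field_simps)
  also have "\<dots> \<longleftrightarrow> (\<exists>l. m = k + 2 * int n * l)"
    by (simp only: mult_cancel_left pi_neq_zero simp_thms of_int_eq_iff)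
  also have "\<dots> \<longleftrightarrow> 2 * int n dvd m - k"
    unfolding dvd_def by (intro ex_cong1) linarith
  finally show ?thesis .
qed

lemma cis_2pi_eq_iff:
  assumes "n > 0"
  shows "cis (2 * pi * of_int a / n) = cis (2 * pi * of_int b / n) \<longleftrightarrow> int n dvd a - b"
proof -
  have "cis (2 * pi * of_int l / n) = cis (pi * of_int (2 * l) / n)" for l
    by (simp add: mult.assoc mult.left_commute)
  then have "cis (2 * pi * of_int a / n) = cis (2 * pi * of_int b / n) \<longleftrightarrow> 2 * int n dvd 2 * (a - b)"
    by (simp only: cis_pi_eq_iff[OF assms] right_diff_distrib)
  then show ?thesis by (simp only: dvd_times_left_cancel_iff)
qed

lemma norm_place: "norm (place n r x) = \<bar>r (snd x)\<bar>"
  by (simp add: place_def norm_mult)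

text \<open>The norm yields equal radii, the parity of the angle index tells spokes from rim edges,
  and \<open>r 0 \<noteq> r 1\<close> tells the rims apart. The radii are generic because both the
  points (\<open>R\<close>) and the circle centres (\<open>X\<close>) are placed this way.\<close>

lemma place_eq_iff:
  assumes n: "n > 0" and r: "\<And>t. t \<le> 2 \<Longrightarrow> r t > 0" "r 0 \<noteq> r 1" and "t \<le> 2" "u \<le> 2"
  shows "place n r (i, t) = place n r (j, u) \<longleftrightarrow> t = u \<and> int n dvd i - j"
proof
  assume eq: "place n r (i, t) = place n r (j, u)"
  then have "\<bar>r t\<bar> = \<bar>r u\<bar>" using norm_place[of n r "(i, t)"] norm_place[of n r "(j, u)"] by simp
  then have ru: "r t = r u" using r(1) assms(4,5) by (metis abs_of_pos)
  moreover have "r u \<noteq> 0" using r(1)[OF assms(5)] by simp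
  ultimately have d: "2 * int n dvd angle_index (i, t) - angle_index (j, u)"
    using eq cis_pi_eq_iff[OF n] by (simp add: place_def)
  then have "even (angle_index (i, t) - angle_index (j, u))" by (rule dvd_mult_left)
  then have "t = 2 \<longleftrightarrow> u = 2" by (auto simp: angle_index_def split: if_splits)
  with d have "2 * int n dvd 2 * (i - j)" by (auto simp: angle_index_def algebra_simps split: if_splits)
  then have "int n dvd i - j" by (simp only: dvd_times_left_cancel_iff)
  moreover have "t = u"
    using \<open>t = 2 \<longleftrightarrow> u = 2\<close> ru r(2) assms(4,5) by (auto simp: numeral_2_eq_2 le_Suc_eq)
  ultimately show "t = u \<and> int n dvd i - j" by simp
next
  assume "t = u \<and> int n dvd i - j"
  then have "2 * int n dvd 2 * (i - j)" by (intro mult_dvd_mono) auto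
  also have "2 * (i - j) = angle_index (i, t) - angle_index (j, u)"
    using \<open>t = u \<and> _\<close> by (simp add: angle_index_def)
  finally have "2 * int n dvd angle_index (i, t) - angle_index (j, u)" .
  then show "place n r (i, t) = place n r (j, u)"
    using \<open>t = u \<and> _\<close> cis_pi_eq_iff[OF n] by (simp add: place_def)
qed

lemma place_eq_iff_prism_edge:
  assumes "n \<ge> 3" "\<And>t. t \<le> 2 \<Longrightarrow> r t > 0" "r 0 \<noteq> r 1" "x \<in> labels" "y \<in> labels"
  shows "place n r x = place n r y \<longleftrightarrow> prism_edge n x = prism_edge n y"
proof -
  obtain i t j u where "x = (i, t)" "y = (j, u)" "t \<le> 2" "u \<le> 2" using assms by auto
  then show ?thesis using assms by (simp add: place_eq_iff prism_edge_eq_iff)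
qed

section \<open>Concyclic neighbours and the circles through them\<close>

text \<open>The law of cosines.\<close>

lemma dist_polar:
  "(dist (of_real a * cis \<alpha>) (of_real b * cis \<beta>))\<^sup>2 = a\<^sup>2 + b\<^sup>2 - 2 * a * b * cos (\<alpha> - \<beta>)"
proof -
  have "(dist (of_real a * cis \<alpha>) (of_real b * cis \<beta>))\<^sup>2 =
      (a * cos \<alpha> - b * cos \<beta>)\<^sup>2 + (a * sin \<alpha> - b * sin \<beta>)\<^sup>2"
    by (simp add: dist_norm cmod_power2)
  also have "\<dots> = a\<^sup>2 * ((sin \<alpha>)\<^sup>2 + (cos \<alpha>)\<^sup>2) + b\<^sup>2 * ((sin \<beta>)\<^sup>2 + (cos \<beta>)\<^sup>2)
      - 2 * a * b * cos (\<alpha> - \<beta>)"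
    by (simp only: cos_diff) algebra
  finally show ?thesis by simp
qed

lemma dist_place:
  "(dist (place n X x) (place n R y))\<^sup>2 = (R (snd y))\<^sup>2 + (X (snd x))\<^sup>2
     - 2 * R (snd y) * X (snd x) * cos (pi * of_int (angle_index x - angle_index y) / n)"
  unfolding place_def dist_polar of_int_diff right_diff_distrib diff_divide_distrib
  by (simp only: add.commute mult.commute mult.left_commute)

text \<open>Each block is symmetric about the line through the origin and its centre, so mirror
  images are equidistant from the centre. The equations \<open>bal\<close> equate the squared
  distances of the two mirror pairs, with the common term \<open>(X t)\<^sup>2\<close>
  cancelled.\<close>

lemma place_mem_label_circle:
  assumes bal: "\<And>t. t < 2 \<Longrightarrow> (R t)\<^sup>2 - 2 * R t * X t * cos (2 * pi / n) =
      (R 2)\<^sup>2 - 2 * R 2 * X t * cos (pi / n)"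
    "(R 0)\<^sup>2 - 2 * R 0 * X 2 * cos (pi / n) = (R 1)\<^sup>2 - 2 * R 1 * X 2 * cos (pi / n)"
    and "x \<in> labels" "y \<in> label_nbrs x"
  shows "place n R y \<in> label_circle n R X x"
proof -
  obtain i t where x: "x = (i, t)" "t \<le> 2" using assms by auto
  obtain j u where y: "y = (j, u)" by force
  \<comment> \<open>Mirror images have angle differences of opposite sign.\<close>
  have c: "cos (- (2 * pi / n)) = cos (2 * pi / n)" "cos (- (pi / n)) = cos (pi / n)"
    by (rule cos_minus)+
  have "(dist (place n X x) (place n R y))\<^sup>2 =
      (let a = R (if snd x = 2 then 0 else 2); b = X (snd x) in a\<^sup>2 + b\<^sup>2 - 2 * a * b * cos (pi / n))"
  proof (cases "t = 2")
    case True
    then show ?thesis unfolding dist_place using assms(4) bal(2) c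
      by (auto simp: x y label_nbrs_def angle_index_def Let_def mult.commute)
  next
    case False
    then have "t < 2" using x(2) by simp
    then show ?thesis unfolding dist_place using assms(4) bal(1)[of t] c
      by (auto simp: x y label_nbrs_def angle_index_def Let_def mult.commute)
  qed
  then show ?thesis
    by (simp add: label_circle_def Let_def real_sqrt_unique)
qed

text \<open>The radicand is
  \<open>(a - b * cos (pi / n))\<^sup>2 + (b * sin (pi / n))\<^sup>2\<close>, whose second term is
  positive.\<close>

lemma radius_pos:
  assumes "n \<ge> 3" "b > 0"
  shows "sqrt (a\<^sup>2 + b\<^sup>2 - 2 * a * b * cos (pi / real n)) > 0"
proof -
  have "sin (pi / n) > 0" using assms by (intro sin_gt_zero) (auto simp: field_simps)
  then have "(a - b * cos (pi / n))\<^sup>2 + (b * sin (pi / n))\<^sup>2 > 0"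
    using assms by (intro add_nonneg_pos) auto
  also have "(a - b * cos (pi / n))\<^sup>2 + (b * sin (pi / n))\<^sup>2 =
      a\<^sup>2 + b\<^sup>2 * ((sin (pi / n))\<^sup>2 + (cos (pi / n))\<^sup>2) - 2 * a * b * cos (pi / n)"
    by algebra
  finally show ?thesis by simp
qed

lemma is_circle_label_circle:
  assumes "n \<ge> 3" "\<And>t. t \<le> 2 \<Longrightarrow> X t > 0" "x \<in> labels"
  shows "is_circle (label_circle n R X x)"
proof -
  have "X (snd x) > 0" using assms by auto
  then show ?thesis
    unfolding is_circle_def label_circle_def Let_def using radius_pos[OF assms(1)] by blast
qed

text \<open>On the line through two different centres, the end points of a diameter of the first
  sphere have distances \<open>\<bar>norm (c - d) + r\<bar>\<close> and
  \<open>\<bar>norm (c - d) - r\<bar>\<close> from \<open>d\<close>. These differ when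
  \<open>r > 0\<close>.\<close>

lemma sphere_center_unique:
  fixes c d :: "'a::euclidean_space"
  assumes "sphere c r = sphere d s" "r > 0"
  shows "c = d"
proof (rule ccontr)
  assume "c \<noteq> d"
  define u where "u = (1 / norm (c - d)) *\<^sub>R (c - d)"
  have u: "norm u = 1" and cd: "c - d = norm (c - d) *\<^sub>R u"
    using \<open>c \<noteq> d\<close> by (simp_all add: u_def)
  have "c + r *\<^sub>R u \<in> sphere d s" "c - r *\<^sub>R u \<in> sphere d s"
    unfolding assms(1)[symmetric] using u assms(2) by (simp_all add: dist_norm)
  moreover have "c + r *\<^sub>R u - d = (norm (c - d) + r) *\<^sub>R u" "c - r *\<^sub>R u - d = (norm (c - d) - r) *\<^sub>R u"
    using cd by (simp_all add: algebra_simps)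
  ultimately have "\<bar>norm (c - d) + r\<bar> = \<bar>norm (c - d) - r\<bar>"
    using u by (simp add: dist_norm norm_minus_commute[of d])
  then show False using assms(2) \<open>c \<noteq> d\<close> by (auto simp: abs_if split: if_splits)
qed

text \<open>A circle determines its centre, so distinct centres give distinct circles. Conversely
  the radius depends only on the type \<open>snd x\<close>, so labels of one edge give one
  circle.\<close>

lemma label_circle_eq_iff:
  assumes "n \<ge> 3" "\<And>t. t \<le> 2 \<Longrightarrow> X t > 0" "X 0 \<noteq> X 1" "x \<in> labels" "y \<in> labels"
  shows "label_circle n R X x = label_circle n R X y \<longleftrightarrow> prism_edge n x = prism_edge n y"
proof
  assume eq: "label_circle n R X x = label_circle n R X y"
  have "X (snd x) > 0" using assms by auto
  have "place n X x = place n X y"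
    by (rule sphere_center_unique[OF eq[unfolded label_circle_def Let_def]])
      (rule radius_pos[OF assms(1) \<open>X (snd x) > 0\<close>])
  then show "prism_edge n x = prism_edge n y"
    using assms place_eq_iff_prism_edge[of n X x y] by simp
next
  assume eq: "prism_edge n x = prism_edge n y"
  then have "place n X x = place n X y"
    using assms place_eq_iff_prism_edge[of n X x y] by simp
  moreover have "snd x = snd y"
    using eq assms prism_edge_eq_iff by (auto split: prod.splits)
  ultimately show "label_circle n R X x = label_circle n R X y"
    by (simp add: label_circle_def)
qed

text \<open>The defining equation of \<open>X t\<close> says that the two point pairs of a block, which form an
  isosceles trapezoid, are equidistant from the centre. It is linear in \<open>X t\<close>, and its solution
  is positive for \<open>R = (1, b, 3)\<close> with \<open>1 < b < 3\<close>. At most one \<open>b\<close> gives \<open>X 0 = X 1\<close>, that is,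
  \<open>(9 + b) * cos (2 * pi / n) = 3 * (1 + b) * cos (pi / n)\<close>.\<close>

lemma obtain_radii:
  assumes "n \<ge> 3"
  obtains R X :: "nat \<Rightarrow> real" where
    "\<And>t. t \<le> 2 \<Longrightarrow> R t > 0" "inj_on R {..2}" "\<And>t. t \<le> 2 \<Longrightarrow> X t > 0" "X 0 \<noteq> X 1"
    "\<And>t. t < 2 \<Longrightarrow> (R t)\<^sup>2 - 2 * R t * X t * cos (2 * pi / real n) =
      (R 2)\<^sup>2 - 2 * R 2 * X t * cos (pi / real n)"
    "(R 0)\<^sup>2 - 2 * R 0 * X 2 * cos (pi / real n) = (R 1)\<^sup>2 - 2 * R 1 * X 2 * cos (pi / real n)"
proof -
  define k where "k = cos (pi / n)"
  define D where "D = cos (2 * pi / n)"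
  have "k > 0" unfolding k_def using assms by (intro cos_gt_zero) (auto simp: field_simps)
  have "D < k" unfolding k_def D_def
    using assms by (intro cos_monotone_0_pi) (auto simp: field_simps)
  have "\<exists>b::real. (b = 2 \<or> b = 3 / 2) \<and> (9 + b) * D \<noteq> 3 * (1 + b) * k"
  proof (cases "(9 + 2) * D = 3 * (1 + 2) * k")
    case True
    \<comment> \<open>Both equations together would give \<open>D = 3 * k\<close>, hence
      \<open>k = 0\<close>.\<close>
    then have "(9 + 3 / 2) * D \<noteq> 3 * (1 + 3 / 2) * k" using \<open>k > 0\<close> by simp
    then show ?thesis by blast
  qed blast
  then obtain b :: real where b: "b = 2 \<or> b = 3 / 2" "(9 + b) * D \<noteq> 3 * (1 + b) * k" by blast
  \<comment> \<open>\<open>p\<close> and \<open>q\<close> are the coefficients of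
    \<open>2 * X t\<close> in the equation for the rims \<open>t = 0\<close> and
    \<open>t = 1\<close>. The spoke equation gives \<open>X 2\<close> after division by
    \<open>b - 1\<close>.\<close>
  define p where "p = 3 * k - D"
  define q where "q = 3 * k - b * D"
  have "p > 0" unfolding p_def using \<open>k > 0\<close> \<open>D < k\<close> by linarith
  have "q > 0" using b(1)
  proof
    assume b: "b = 2" show ?thesis unfolding q_def b using \<open>k > 0\<close> \<open>D < k\<close> by linarith
  next
    assume b: "b = 3 / 2" show ?thesis unfolding q_def b using \<open>k > 0\<close> \<open>D < k\<close> by linarith
  qed
  define R where "R = (\<lambda>t::nat. if t = 0 then 1 else if t = 1 then b else 3)"
  define X where "X = (\<lambda>t::nat. if t = 0 then 4 / p
    else if t = 1 then (9 - b\<^sup>2) / (2 * q) else (1 + b) / (2 * k))"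
  have "1 < b" "b \<le> 2" using b(1) by (elim disjE; linarith)+
  then have b2: "b\<^sup>2 < 9" "b > 0" using power_strict_mono[of b 3 2] by auto
  show thesis
  proof
    show "R t > 0" for t using b2 by (simp add: R_def)
    show "inj_on R {..2}" using b(1) by (auto simp: R_def inj_on_def)
    show "X t > 0" for t using b2 \<open>p > 0\<close> \<open>q > 0\<close> \<open>k > 0\<close> by (simp add: X_def)
    show "X 0 \<noteq> X 1"
    proof
      assume "X 0 = X 1"
      then have "8 * q = (9 - b\<^sup>2) * p"
        using \<open>p > 0\<close> \<open>q > 0\<close> by (simp add: X_def field_simps)
      then have "8 * (3 * k - b * D) = (9 - b\<^sup>2) * (3 * k - D)" by (simp only: p_def q_def)
      \<comment> \<open>The first factor vanishes only if the rims have equal radii, the second is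
        nonzero by the choice of \<open>b\<close>.\<close>
      then have "(b - 1) * ((9 + b) * D - 3 * (1 + b) * k) = 0" by algebra
      then show False using b by auto
    qed
    show "(R t)\<^sup>2 - 2 * R t * X t * cos (2 * pi / n) = (R 2)\<^sup>2 - 2 * R 2 * X t * cos (pi / n)"
      if "t < 2" for t
    proof -
      have "(R 2)\<^sup>2 - (R t)\<^sup>2 = 2 * X t * (if t = 0 then p else q)"
        using that \<open>p > 0\<close> \<open>q > 0\<close> by (auto simp: R_def X_def less_2_cases_iff)
      also have "\<dots> = 2 * X t * (3 * k - R t * D)"
        using that by (auto simp: p_def q_def R_def less_2_cases_iff)
      finally have "(R 2)\<^sup>2 - (R t)\<^sup>2 = 2 * X t * (3 * k - R t * D)" .
      then show ?thesis by (simp add: k_def D_def R_def algebra_simps)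
    qed
    show "(R 0)\<^sup>2 - 2 * R 0 * X 2 * cos (pi / n) = (R 1)\<^sup>2 - 2 * R 1 * X 2 * cos (pi / n)"
      unfolding k_def[symmetric] using \<open>k > 0\<close> by (simp add: R_def X_def power2_eq_square field_simps)
  qed
qed

subsection \<open>The symmetry group\<close>

definition dihedral_action :: "nat \<Rightarrow> int \<times> bool \<Rightarrow> complex \<Rightarrow> complex" where
  "dihedral_action n = (\<lambda>(a, s) z. cis (2 * pi * of_int a / n) * (if s then cnj z else z))"

text \<open>Conjugation negates the angle index. For a rim edge
  \<open>-(2 * i + 1) = 2 * (- i - 1) + 1\<close>, which explains the shift.\<close>

definition label_action :: "int \<times> bool \<Rightarrow> int \<times> nat \<Rightarrow> int \<times> nat" where
  "label_action = (\<lambda>(a, s) (i, t). (a + (if s then (if t = 2 then - i else - i - 1) else i), t))"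

lemma dihedral_action_place:
  assumes "n > 0"
  shows "dihedral_action n g (place n r x) = place n r (label_action g x)"
proof -
  obtain a s i t where gx: "g = (a, s)" "x = (i, t)" by (metis prod.collapse)
  show ?thesis
    by (auto simp: gx dihedral_action_def label_action_def place_def angle_index_def cis_cnj cis_mult
       add_divide_distrib diff_divide_distrib algebra_simps)
qed

lemma label_action_labels: "x \<in> labels \<Longrightarrow> label_action g x \<in> labels"
  by (auto simp: label_action_def split: prod.splits)

lemma snd_label_action [simp]: "snd (label_action g x) = snd x"
  by (simp add: label_action_def split: prod.splits)

text \<open>Conjugation inverts the rotation that it is moved past, which matches the sign in the
  dihedral product; reduction modulo \<open>n\<close> leaves \<open>cis\<close> unchanged.\<close>

lemma dihedral_action_mult:
  assumes "n > 0"
  shows "dihedral_action n (g \<otimes>\<^bsub>dihedral_group n\<^esub> h) = dihedral_action n g \<circ> dihedral_action n h"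
proof -
  obtain a s b t where gh: "g = (a, s)" "h = (b, t)" by (metis prod.collapse)
  have m: "cis (2 * pi * of_int (l mod int n) / n) = cis (2 * pi * of_int l / n)" for l
    unfolding cis_2pi_eq_iff[OF assms(1)] by (simp flip: mod_eq_dvd_iff)
  show ?thesis
    by (cases s; cases t) (simp_all add: gh fun_eq_iff dihedral_action_def dihedral_group_def m cis_mult
       cis_cnj add_divide_distrib diff_divide_distrib distrib_left right_diff_distrib mult.assoc[symmetric])
qed

lemma dist_dihedral_action:
  "dist (dihedral_action n g z) (dihedral_action n g w) = dist z w"
proof -
  obtain a s where g: "g = (a, s)" by force
  have "dist (u * z) (u * w) = dist z w" if "norm u = 1" for u z w :: complex
    using that by (simp add: dist_norm norm_mult flip: right_diff_distrib)
  moreover have "dist (cnj z) (cnj w) = dist z w"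
    by (metis complex_cnj_diff complex_mod_cnj dist_norm)
  ultimately show ?thesis by (simp add: g dihedral_action_def)
qed

lemma dihedral_action_isometry: "dihedral_action n g \<in> plane_isometries"
proof -
  obtain a s where g: "g = (a, s)" by force
  let ?u = "cis (2 * pi * of_int a / n)"
  have "bij (dihedral_action n g)"
  proof (rule o_bij)
    let ?h = "\<lambda>w. if s then cnj (w / ?u) else w / ?u"
    show "?h \<circ> dihedral_action n g = id" "dihedral_action n g \<circ> ?h = id"
      by (auto simp: g dihedral_action_def fun_eq_iff)
  qed
  then show ?thesis by (simp add: plane_isometries_def dist_dihedral_action)
qed

section \<open>Isometries of the plane and the centroid\<close>

lemma image_sphere_isometry:
  assumes "f \<in> plane_isometries"
  shows "f ` sphere c r = sphere (f c) r"
proof -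
  have f: "surj f" "\<And>x y. dist (f x) (f y) = dist x y"
    using assms by (auto simp: plane_isometries_def bij_def)
  show ?thesis
  proof (intro equalityI subsetI)
    fix w assume w: "w \<in> sphere (f c) r"
    obtain z where z: "w = f z" using f(1) by (rule surjE)
    then show "w \<in> f ` sphere c r" using w f(2) by simp
  qed (auto simp: f(2))
qed

text \<open>After normalisation, \<open>h\<close> preserves distances and fixes 0 and 1. Distances
  from 0 and 1 determine the real part of \<open>h z\<close> and the square of its imaginary part;
  the distance from \<open>h \<i>\<close> settles the sign.\<close>

lemma plane_isometry_cases:
  assumes "f \<in> plane_isometries"
  obtains u where "norm u = 1" "\<And>z. f z = f 0 + u * z" | u where "norm u = 1" "\<And>z. f z = f 0 + u * cnj z"
proof -
  have d: "cmod (f x - f y) = cmod (x - y)" for x y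
    using assms by (simp add: plane_isometries_def dist_norm)
  define u where "u = f 1 - f 0"
  have u: "norm u = 1" using d[of 1 0] by (simp add: u_def)
  then have u0: "u \<noteq> 0" by auto
  define h where "h = (\<lambda>z. (f z - f 0) / u)"
  have f: "f z = f 0 + u * h z" for z using u0 by (simp add: h_def)
  have hd: "cmod (h x - h y) = cmod (x - y)" for x y
    using d u by (simp add: h_def norm_divide flip: diff_divide_distrib)
  have h0: "h 0 = 0" and h1: "h 1 = 1" using u0 by (simp_all add: h_def u_def)
  have sq: "(Re z)\<^sup>2 + (Im z)\<^sup>2 = (Re (h z))\<^sup>2 + (Im (h z))\<^sup>2" for z
    using hd[of z 0] by (metis cmod_power2 diff_zero h0)
  have re: "Re (h z) = Re z" for z
  proof -
    have "(Re z - 1)\<^sup>2 + (Im z)\<^sup>2 = (Re (h z) - 1)\<^sup>2 + (Im (h z))\<^sup>2"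
      using arg_cong[OF hd[of z 1], of "\<lambda>x. x\<^sup>2"] by (simp add: cmod_power2 h1)
    then show ?thesis using sq[of z] by (simp add: power2_eq_square algebra_simps)
  qed
  \<comment> \<open>Expanding and cancelling equal squares gives
    \<open>Im (h z) * Im (h \<i>) = Im z\<close>, so one sign serves all \<open>z\<close>.\<close>
  have im: "(Im (h z) - Im (h \<i>))\<^sup>2 = (Im z - 1)\<^sup>2" for z
    using arg_cong[OF hd[of z \<i>], of "\<lambda>x. x\<^sup>2"] by (simp add: cmod_power2 re)
  have im2: "(Im (h z))\<^sup>2 = (Im z)\<^sup>2" for z using sq[of z] by (simp add: re)
  have "Im (h \<i>) = 1 \<or> Im (h \<i>) = -1" using im2[of \<i>] by (simp add: power2_eq_1_iff)
  then show thesis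
  proof
    assume "Im (h \<i>) = 1"
    then have "Im (h z) = Im z" for z
      using im[of z] im2[of z] by (simp add: power2_eq_square algebra_simps)
    then have "h z = z" for z by (simp add: complex_eq_iff re)
    then show thesis using that(1) u f by metis
  next
    assume "Im (h \<i>) = -1"
    then have "Im (h z) = - Im z" for z
      using im[of z] im2[of z] by (simp add: power2_eq_square algebra_simps)
    then have "h z = cnj z" for z by (simp add: complex_eq_iff re)
    then show thesis using that(2) u f by metis
  qed
qed

text \<open>Multiplication by \<open>w\<close> permutes \<open>P\<close>, so the sum equals
  \<open>w\<close> times itself.\<close>

lemma sum_eq_0_of_rotation:
  fixes P :: "complex set"
  assumes "(*) w ` P = P" "w \<noteq> 1" "w \<noteq> 0"
  shows "\<Sum>P = 0"
proof -
  have "\<Sum>P = \<Sum>((*) w ` P)" using assms(1) by simp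
  also have "\<dots> = (\<Sum>p\<in>P. w * p)" using assms(3) by (subst sum.reindex) (auto simp: inj_on_def)
  also have "\<dots> = w * \<Sum>P" by (simp add: sum_distrib_left)
  finally have "(1 - w) * \<Sum>P = 0" by (simp add: algebra_simps)
  then show ?thesis using assms(2) by simp
qed

lemma isometry_fixes_0:
  assumes f: "f \<in> plane_isometries" "f ` P = P" and P: "finite P" "P \<noteq> {}" "\<Sum>P = 0"
  shows "f 0 = 0"
proof -
  have "inj f" using f(1) by (simp add: plane_isometries_def bij_def)
  then have "inj_on f P" by (rule inj_on_subset) simp
  then have "(\<Sum>p\<in>P. f p) = \<Sum>(f ` P)" by (simp add: sum.reindex)
  then have s: "(\<Sum>p\<in>P. f p) = 0" using f(2) P(3) by simp
  have c: "(\<Sum>p\<in>P. cnj p) = 0" using arg_cong[OF P(3), of cnj] by (simp add: cnj_sum)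
  from f(1) have "(\<Sum>p\<in>P. f p) = of_nat (card P) * f 0"
  proof (cases rule: plane_isometry_cases)
    case (1 u)
    have "(\<Sum>p\<in>P. f p) = (\<Sum>p\<in>P. f 0 + u * p)" by (intro sum.cong refl) (rule 1(2))
    also have "\<dots> = of_nat (card P) * f 0 + u * \<Sum>P" by (simp add: sum.distrib sum_distrib_left)
    finally show ?thesis using P(3) by simp
  next
    case (2 u)
    have "(\<Sum>p\<in>P. f p) = (\<Sum>p\<in>P. f 0 + u * cnj p)" by (intro sum.cong refl) (rule 2(2))
    also have "\<dots> = of_nat (card P) * f 0 + u * (\<Sum>p\<in>P. cnj p)"
      by (simp add: sum.distrib sum_distrib_left)
    finally show ?thesis using c by simp
  qed
  then show ?thesis using s P by auto
qed

section \<open>Identification with the dihedral group\<close>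

lemma carrier_symmetry_group_iff:
  "f \<in> carrier (symmetry_group P \<C>) \<longleftrightarrow>
    f \<in> plane_isometries \<and> f ` P = P \<and> (\<lambda>C. f ` C) ` \<C> = \<C>"
  by (simp add: symmetry_group_def)

lemma mult_symmetry_group:
  assumes "f \<in> plane_isometries" "g \<in> plane_isometries"
  shows "f \<otimes>\<^bsub>symmetry_group P \<C>\<^esub> g = f \<circ> g"
  using assms by (simp add: symmetry_group_def BijGroup_def plane_isometries_def Bij_def compose_def fun_eq_iff)

text \<open>The set \<open>labels\<close> is infinite, but \<open>g\<close> factors through the
  finitely many prism edges.\<close>

lemma finite_image_labels:
  assumes "n \<ge> 3" "\<And>x y. x \<in> labels \<Longrightarrow> y \<in> labels \<Longrightarrow> prism_edge n x = prism_edge n y \<Longrightarrow> g x = g y"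
  shows "finite (g ` labels)"
proof -
  have "g x = g (inv_into labels (prism_edge n) (prism_edge n x))" if "x \<in> labels" for x
    using that
    by (intro assms(2) inv_into_into f_inv_into_f[symmetric] imageI)
  then have "g ` labels \<subseteq> (\<lambda>e. g (inv_into labels (prism_edge n) e)) ` prism_edge n ` labels"
    by blast
  moreover have "finite (prism_edge n ` labels)"
    using card_verts_CO(1)[OF assms(1)] verts_CO[of n] assms(1) by simp
  ultimately show ?thesis by (blast intro: finite_subset)
qed

text \<open>The isomorphism is \<open>dihedral_action n\<close>, read backwards at the end. For
  surjectivity the point set alone leaves only the dihedral maps; the circles matter for showing
  that those maps are symmetries.\<close>

lemma symmetry_group_iso_dihedral:
  assumes n: "n \<ge> 3" and R: "\<And>t. t \<le> 2 \<Longrightarrow> R t > 0" "inj_on R {..2}"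
    and X: "\<And>t. t \<le> 2 \<Longrightarrow> X t > 0" "X 0 \<noteq> X 1"
  shows "symmetry_group (place n R ` labels) (label_circle n R X ` labels) \<cong> dihedral_group n"
proof -
  let ?P = "place n R ` labels" and ?\<C> = "label_circle n R X ` labels"
  let ?S = "symmetry_group ?P ?\<C>"
  have n0: "n > 0" using n by simp
  have R01: "R 0 \<noteq> R 1" using inj_onD[OF R(2), of 0 1] by auto
  have fP: "finite ?P"
    by (rule finite_image_labels[OF n])
      (rule place_eq_iff_prism_edge[OF n R(1) R01, THEN iffD2])
  have fC: "finite ?\<C>"
    by (rule finite_image_labels[OF n]) (rule label_circle_eq_iff[OF n X, THEN iffD2])
  have act: "dihedral_action n g \<in> carrier ?S" for g
  proof -
    let ?f = "dihedral_action n g"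
    have f: "?f \<in> plane_isometries" by (rule dihedral_action_isometry)
    then have inj: "inj ?f" by (simp add: plane_isometries_def bij_def)
    have "?f ` ?P \<subseteq> ?P"
      unfolding image_image dihedral_action_place[OF n0]
      by (intro image_subsetI imageI label_action_labels)
    moreover have "(\<lambda>C. ?f ` C) ` ?\<C> \<subseteq> ?\<C>"
    proof -
      have "?f ` label_circle n R X x = label_circle n R X (label_action g x)" for x
        by (simp add: label_circle_def image_sphere_isometry[OF f] dihedral_action_place[OF n0])
      then show ?thesis
        unfolding image_image by (simp only:) (intro image_subsetI imageI label_action_labels)
    qed
    \<comment> \<open>Injective maps of finite sets into themselves are onto, so both inclusions
      become equalities.\<close>
    moreover have "inj_on (\<lambda>C. ?f ` C) ?\<C>"
      using inj by (simp add: inj_on_def inj_image_eq_iff)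
    ultimately show ?thesis
      using f inj fP fC by (simp add: carrier_symmetry_group_iff endo_inj_surj inj_on_subset)
  qed
  have "\<Sum>?P = 0"
  proof (rule sum_eq_0_of_rotation)
    show "(*) (cis (2 * pi / n)) ` ?P = ?P"
      using act[of "(1, False)"] by (simp add: carrier_symmetry_group_iff dihedral_action_def)
    show "cis (2 * pi / n) \<noteq> 1"
      using cis_2pi_eq_iff[OF n0, of 1 0] not_dvd_small[OF n, of 1] by simp
  qed simp
  have surj: "\<exists>g \<in> carrier (dihedral_group n). f = dihedral_action n g" if f: "f \<in> carrier ?S" for f
  proof -
    have fi: "f \<in> plane_isometries" "f ` ?P = ?P" using f by (simp_all add: carrier_symmetry_group_iff)
    have f0: "f 0 = 0"
      by (rule isometry_fixes_0[OF fi fP _ \<open>\<Sum>?P = 0\<close>]) auto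
    obtain u s where u: "norm u = 1" "\<And>z. f z = u * (if s then cnj z else z)"
      using fi(1)
    proof (cases rule: plane_isometry_cases)
      case (1 u)
      have "f z = u * (if False then cnj z else z)" for z using 1(2)[of z] f0 by simp
      with 1(1) show thesis by (rule that)
    next
      case (2 u)
      have "f z = u * (if True then cnj z else z)" for z using 2(2)[of z] f0 by simp
      with 2(1) show thesis by (rule that)
    qed
    \<comment> \<open>This spoke point is real, so its image is \<open>u * R 2\<close> whether or
      not \<open>f\<close> conjugates.\<close>
    have p: "place n R (0, 2) = of_real (R 2)" by (simp add: place_def angle_index_def)
    have "f (place n R (0, 2)) \<in> ?P" using fi(2) by blast
    then obtain j t where jt: "u * of_real (R 2) = place n R (j, t)" "t \<le> 2"
      unfolding p u(2) complex_cnj_complex_of_real if_cancel by (elim imageE SigmaE) auto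
    \<comment> \<open>Comparing norms shows that the image is again a spoke point, because the three
      radii differ.\<close>
    have "R 2 = R t"
      using arg_cong[OF jt(1), of norm] R(1)[OF jt(2)] R(1)[of 2] u(1) by (simp add: norm_place norm_mult)
    then have "t = 2" using R(2) jt(2) by (auto simp: inj_on_def)
    then have "u = cis (2 * pi * of_int j / n)"
      using jt(1) R(1)[of 2] by (simp add: place_def angle_index_def mult.commute mult.left_commute)
    also have "\<dots> = cis (2 * pi * of_int (j mod int n) / n)"
      unfolding cis_2pi_eq_iff[OF n0] by (simp flip: mod_eq_dvd_iff)
    finally have "f = dihedral_action n (j mod int n, s)"
      using u(2) by (auto simp: dihedral_action_def fun_eq_iff)
    moreover have "(j mod int n, s) \<in> carrier (dihedral_group n)"
      using n by (simp add: dihedral_group_def)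
    ultimately show ?thesis by blast
  qed
  have inj: "inj_on (dihedral_action n) (carrier (dihedral_group n))"
  proof (rule inj_onI)
    fix g h assume gh: "g \<in> carrier (dihedral_group n)" "h \<in> carrier (dihedral_group n)"
      and eq: "dihedral_action n g = dihedral_action n h"
    obtain a s b t where ab: "g = (a, s)" "h = (b, t)" by (metis prod.collapse)
    \<comment> \<open>The value at the real number 1 is blind to conjugation and yields the
      rotation; the value at \<open>\<i>\<close> then detects conjugation.\<close>
    have c: "cis (2 * pi * of_int a / n) = cis (2 * pi * of_int b / n)"
      using fun_cong[OF eq, of 1] by (cases s; cases t) (simp_all add: ab dihedral_action_def)
    then have "int n dvd a - b" by (simp only: cis_2pi_eq_iff[OF n0])
    then have "a = b" using gh by (simp add: ab dihedral_group_def flip: mod_eq_dvd_iff)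
    moreover have "s = t"
    proof -
      have "(if s then cnj \<i> else \<i>) = (if t then cnj \<i> else \<i>)"
        using fun_cong[OF eq, of \<i>] c
        by (simp only: ab dihedral_action_def prod.case mult_cancel_left cis_neq_zero simp_thms)
      then show ?thesis by (auto simp: complex_eq_iff split: if_splits)
    qed
    ultimately show "g = h" by (simp add: ab)
  qed
  have "dihedral_action n \<in> iso (dihedral_group n) ?S"
    unfolding iso_def
  proof (intro CollectI conjI homI)
    show "dihedral_action n (g \<otimes>\<^bsub>dihedral_group n\<^esub> h) =
        dihedral_action n g \<otimes>\<^bsub>?S\<^esub> dihedral_action n h"
      if "g \<in> carrier (dihedral_group n)" "h \<in> carrier (dihedral_group n)" for g h
      using dihedral_action_mult[OF n0] by (simp add: mult_symmetry_group dihedral_action_isometry)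
    show "bij_betw (dihedral_action n) (carrier (dihedral_group n)) (carrier ?S)"
      unfolding bij_betw_def using inj act surj by blast
  qed (rule act)
  then show ?thesis
    using group.iso_sym[OF group_dihedral_group[OF n0]] by (auto simp: is_iso_def)
qed

section \<open>Assembling the realization\<close>

lemma order_eq_of_iso: "G \<cong> H \<Longrightarrow> order G = order H"
  by (auto simp: is_iso_def iso_def order_def intro: bij_betw_same_card)

theorem theorem5p4:
  fixes n :: nat
  assumes "n \<ge> 3"
    and "S = V_construction (generalized_cuboctahedron_graph n)"
  shows "is_configuration S (3 * n) 4 \<and>
    (\<exists>pt circ. point_circle_realization S pt circ \<and>
       symmetry_group (pt ` points S) (circ ` blocks S) \<cong> dihedral_group n \<and>
       order (symmetry_group (pt ` points S) (circ ` blocks S)) = 2 * n)"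
proof (intro conjI)
  show "is_configuration S (3 * n) 4"
    unfolding assms(2) using assms(1)
    by (intro is_configuration_V_construction card_verts_CO inj_on_neighbourhood_CO
        card_neighbourhood_CO)
next
  let ?G = "generalized_cuboctahedron_graph n"
  obtain R X :: "nat \<Rightarrow> real" where R: "\<And>t. t \<le> 2 \<Longrightarrow> R t > 0" "inj_on R {..2}"
    and X: "\<And>t. t \<le> 2 \<Longrightarrow> X t > 0" "X 0 \<noteq> X 1"
    and bal: "\<And>t. t < 2 \<Longrightarrow> (R t)\<^sup>2 - 2 * R t * X t * cos (2 * pi / real n) =
      (R 2)\<^sup>2 - 2 * R 2 * X t * cos (pi / real n)"
    "(R 0)\<^sup>2 - 2 * R 0 * X 2 * cos (pi / real n) = (R 1)\<^sup>2 - 2 * R 1 * X 2 * cos (pi / real n)"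
    using obtain_radii[OF assms(1)] by blast
  have R01: "R 0 \<noteq> R 1" using inj_onD[OF R(2), of 0 1] by auto
  note pl = place_eq_iff_prism_edge[OF assms(1) R(1) R01]
  note ci = label_circle_eq_iff[OF assms(1) X]
  \<comment> \<open>An arbitrary label is chosen for each edge; by \<open>pl\<close> and
    \<open>ci\<close>, the point and the circle do not depend on the choice.\<close>
  define lab where "lab = inv_into labels (prism_edge n)"
  have lab: "lab (prism_edge n x) \<in> labels" "prism_edge n (lab (prism_edge n x)) = prism_edge n x"
    if "x \<in> labels" for x
    unfolding lab_def using that by (intro inv_into_into f_inv_into_f imageI; simp)+
  define pt where "pt = (\<lambda>v. place n R (lab v))"
  \<comment> \<open>A block is traced back to its vertex, which is unique since neighbourhoods are
    distinct.\<close>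
  define circ where "circ = (\<lambda>b. label_circle n R X (lab (inv_into (verts ?G) (neighbourhood ?G) b)))"
  have V: "verts ?G = prism_edge n ` labels" using assms(1) by (simp add: verts_CO)
  have pt: "pt (prism_edge n x) = place n R x" if "x \<in> labels" for x
    using that pl lab by (simp add: pt_def)
  have circ: "circ (neighbourhood ?G (prism_edge n x)) = label_circle n R X x" if "x \<in> labels" for x
  proof -
    have "inv_into (verts ?G) (neighbourhood ?G) (neighbourhood ?G (prism_edge n x)) = prism_edge n x"
      using that V inv_into_f_f[OF inj_on_neighbourhood_CO[OF assms(1)]] by blast
    then show ?thesis using that ci lab by (simp add: circ_def)
  qed
  have pts: "points S = prism_edge n ` labels" and bls: "blocks S = (\<lambda>x. neighbourhood ?G (prism_edge n x)) ` labels"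
    and inc: "incident S = (\<in>)"
    by (simp_all only: assms(2) V_construction_def V image_image incidence_structure.simps)
  have "point_circle_realization S pt circ"
    unfolding point_circle_realization_def pts bls inc
  proof (intro conjI ballI impI)
    show "inj_on pt (prism_edge n ` labels)"
    proof (intro inj_onI; elim imageE)
      fix p q x y assume "pt p = pt q" "p = prism_edge n x" "q = prism_edge n y" "x \<in> labels" "y \<in> labels"
      then show "p = q" by (simp only: pt pl)
    qed
    show "inj_on circ ((\<lambda>x. neighbourhood ?G (prism_edge n x)) ` labels)"
    proof (intro inj_onI; elim imageE)
      fix b c x y assume "circ b = circ c" "b = neighbourhood ?G (prism_edge n x)"
        "c = neighbourhood ?G (prism_edge n y)" "x \<in> labels" "y \<in> labels"
      then show "b = c" by (simp only: circ ci)
    qed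
    show "is_circle (circ b)" if "b \<in> (\<lambda>x. neighbourhood ?G (prism_edge n x)) ` labels" for b
      using that
    proof (elim imageE)
      fix x assume "b = neighbourhood ?G (prism_edge n x)" "x \<in> labels"
      then show ?thesis by (simp only: circ is_circle_label_circle[OF assms(1) X(1)])
    qed
    show "pt p \<in> circ b"
      if bp: "b \<in> (\<lambda>x. neighbourhood ?G (prism_edge n x)) ` labels" "p \<in> b" for p b
    proof -
      obtain x where x: "b = neighbourhood ?G (prism_edge n x)" "x \<in> labels"
        using bp(1) by (rule imageE)
      have "p \<in> prism_edge n ` label_nbrs x"
        using bp(2) by (simp only: x(1) neighbourhood_CO[OF assms(1) x(2)])
      then obtain y where y: "p = prism_edge n y" "y \<in> label_nbrs x" by (rule imageE)
      then have "y \<in> labels" using label_nbrs_subset[OF x(2)] by blast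
      then show ?thesis
        using place_mem_label_circle[OF bal x(2) y(2)] by (simp only: pt circ x y)
    qed
  qed
  moreover have "pt ` points S = place n R ` labels"
    unfolding pts image_image by (intro image_cong refl pt)
  moreover have "circ ` blocks S = label_circle n R X ` labels"
    unfolding bls image_image by (intro image_cong refl circ)
  moreover note iso = symmetry_group_iso_dihedral[OF assms(1) R X]
  ultimately show "\<exists>pt circ. point_circle_realization S pt circ \<and>
       symmetry_group (pt ` points S) (circ ` blocks S) \<cong> dihedral_group n \<and>
       order (symmetry_group (pt ` points S) (circ ` blocks S)) = 2 * n"
    using order_eq_of_iso[OF iso] by (intro exI[of _ pt] exI[of _ circ]) (simp add: order_dihedral_group)
qed

end
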